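(* Consider the reduced networked SVIRS system below on a connected weighted undirected graph, with nonnegative parameters satisfying $N>0$, $0<r<1$, $\mu>0$, $\beta>0$, $0\le p\le1$, $0\le\sigma\le1$, $0<\epsilon\le1$, and with $\eta=0$. If $\mathcal R_0>1$, then the endemic equilibrium $\mathbf E=(S_*,V_*,I_* )$ (constant over all nodes, with $S_*,V_*,I_*>0$) is globally asymptotically stable: for every solution with $S(x,0),V(x,0),I(x,0)>0$ at every node $x$, $\lim_{t\to\infty}(S,V,I)(x,t)=(S_*,V_*,I_* )$ uniformly in $x\in\mathcal V$.
   Context: Let $G=\langle \mathcal V,\mathcal E,\mathcal W\rangle$ be a connected weighted undirected graph without self-loops, $|\mathcal V|=n$, with weights $w(x,y)=w(y,x)>0$ for adjacent nodes $x\sim y$. For $F:\mathcal V\to\mathbb R$ define $\Delta F(x)=\sum_{y\in\mathcal V,\,y\sim x} w(x,y)\,[F(y)-F(x)]$. The reduced SVIRS model (obtained from an SVIRS model with total population $S+V+I+R=N$ at each node by substituting $R=N-S-V-I$) is, for $(x,t)\in\mathcal V\times[0,\infty)$, $\frac{dS}{dt}-\epsilon\Delta S=\mu(1-r)N-(\mu+p)S-\beta SI+\xi V+\eta(N-S-V-I)$, $\frac{dV}{dt}-\epsilon\Delta V=\mu rN+pS-\beta\sigma VI-(\mu+\xi)V$, $\frac{dI}{dt}-\epsilon\Delta I=\beta SI+\beta\sigma VI-(\mu+\gamma)I$. The endemic equilibrium $(S_*,V_*,I_* )$ is the constant positive solution of $0=\mu(1-r)N-(\mu+p)S-\beta SI+\xi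 V+\eta(N-S-V-I)$, $0=\mu rN+pS-\beta\sigma VI-(\mu+\xi)V$, $0=\beta S+\beta\sigma V-(\mu+\gamma)$. The basic reproduction number is $\mathcal R_0=\dfrac{\beta\big((\xi+(1-r)\mu)+\sigma(p+\mu r)\big)N}{(\gamma+\mu)(\mu+p+\xi)}$. *)

theory Defs
  imports "HOL-Analysis.Analysis"
begin

text \<open>Connected weighted undirected graph without self-loops on the finite vertex type 'v.
  Adjacency x ~ y means w x y > 0; non-adjacent pairs have weight 0.\<close>
definition weighted_graph :: "('v::finite \<Rightarrow> 'v \<Rightarrow> real) \<Rightarrow> bool" where
  "weighted_graph w \<longleftrightarrow>
     (\<forall>x y. w x y = w y x) \<and> (\<forall>x y. 0 \<le> w x y) \<and> (\<forall>x. w x x = 0) \<and>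
     (\<forall>x y. (x, y) \<in> {(a, b). 0 < w a b}\<^sup>*)"

text \<open>Graph Laplacian: Delta F x = sum over neighbours y of w(x,y) (F y - F x).\<close>
definition graph_laplacian :: "('v::finite \<Rightarrow> 'v \<Rightarrow> real) \<Rightarrow> ('v \<Rightarrow> real) \<Rightarrow> 'v \<Rightarrow> real" where
  "graph_laplacian w F x = (\<Sum>y\<in>{y. 0 < w x y}. w x y * (F y - F x))"

definition R0_svirs :: "real \<Rightarrow> real \<Rightarrow> real \<Rightarrow> real \<Rightarrow> real \<Rightarrow> real \<Rightarrow> real \<Rightarrow> real \<Rightarrow> real" where
  "R0_svirs N r \<mu> \<beta> p \<xi> \<sigma> \<gamma> =
     \<beta> * ((\<xi> + (1 - r) * \<mu>) + \<sigma> * (p + \<mu> * r)) * N / ((\<gamma> + \<mu>) * (\<mu> + p + \<xi>))"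

text \<open>Constant equilibrium equations of the reduced SVIRS model.\<close>
definition svirs_equilibrium ::
  "real \<Rightarrow> real \<Rightarrow> real \<Rightarrow> real \<Rightarrow> real \<Rightarrow> real \<Rightarrow> real \<Rightarrow> real \<Rightarrow> real \<Rightarrow> real \<Rightarrow> real \<Rightarrow> real \<Rightarrow> bool" where
  "svirs_equilibrium N r \<mu> \<beta> p \<xi> \<sigma> \<gamma> \<eta> Ss Vs Is \<longleftrightarrow>
     0 = \<mu> * (1 - r) * N - (\<mu> + p) * Ss - \<beta> * Ss * Is + \<xi> * Vs + \<eta> * (N - Ss - Vs - Is) \<and>
     0 = \<mu> * r * N + p * Ss - \<beta> * \<sigma> * Vs * Is - (\<mu> + \<xi>) * Vs \<and>
     0 = \<beta> * Ss + \<beta> * \<sigma> * Vs - (\<mu> + \<gamma>)"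

text \<open>A (global, classical) solution on V x [0,\<infinity>) of the reduced networked SVIRS model;
  time derivatives at t = 0 are one-sided.\<close>
definition svirs_solution ::
  "('v::finite \<Rightarrow> 'v \<Rightarrow> real) \<Rightarrow> real \<Rightarrow> real \<Rightarrow> real \<Rightarrow> real \<Rightarrow> real \<Rightarrow> real \<Rightarrow> real \<Rightarrow> real \<Rightarrow> real \<Rightarrow> real \<Rightarrow>
   ('v \<Rightarrow> real \<Rightarrow> real) \<Rightarrow> ('v \<Rightarrow> real \<Rightarrow> real) \<Rightarrow> ('v \<Rightarrow> real \<Rightarrow> real) \<Rightarrow> bool" where
  "svirs_solution w \<epsilon> N r \<mu> \<beta> p \<xi> \<sigma> \<gamma> \<eta> S V I \<longleftrightarrow>
     (\<forall>x. \<forall>t\<ge>0.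
        ((\<lambda>s. S x s) has_real_derivative
           (\<epsilon> * graph_laplacian w (\<lambda>y. S y t) x + \<mu> * (1 - r) * N - (\<mu> + p) * S x t
            - \<beta> * S x t * I x t + \<xi> * V x t + \<eta> * (N - S x t - V x t - I x t))) (at t within {0..}) \<and>
        ((\<lambda>s. V x s) has_real_derivative
           (\<epsilon> * graph_laplacian w (\<lambda>y. V y t) x + \<mu> * r * N + p * S x t
            - \<beta> * \<sigma> * V x t * I x t - (\<mu> + \<xi>) * V x t)) (at t within {0..}) \<and>
        ((\<lambda>s. I x s) has_real_derivative
           (\<epsilon> * graph_laplacian w (\<lambda>y. I y t) x + \<beta> * S x t * I x t + \<beta> * \<sigma> * V x t * I x t
            - (\<mu> + \<gamma>) * I x t)) (at t within {0..}))"

end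

theory Submission
  imports Defs
begin

text \<open>
  The sum over all nodes of the Volterra functions \<open>z - a - a ln (z / a)\<close> of \<open>S\<close>, \<open>V\<close>, \<open>I\<close>, with \<open>a\<close> the
  corresponding equilibrium value, is a Lyapunov function.  By symmetry of the weights the Laplacian
  contributes a nonpositive amount to its derivative.  In the reaction part the terms containing \<open>I\<close>
  cancel, and what remains is a balanced flow between two compartments, which dissipates at least
  a multiple of \<open>(S - Ss)\<^sup>2 / S + (V - Vs)\<^sup>2 / V\<close>.  Hence solutions stay in a compact subset of the
  open positive octant, and Barbalat's lemma, applied to the Lyapunov function, gives \<open>S \<rightarrow> Ss\<close> and
  \<open>V \<rightarrow> Vs\<close>.  A second application, to \<open>S\<close>, shows that the time derivative of \<open>S\<close> vanishes in the limit,
  so the equation for \<open>S\<close> forces \<open>I \<rightarrow> Is\<close>.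
\<close>

section \<open>Bounded Lipschitz functions on the half-line\<close>

definition bounded_lipschitz :: "(real \<Rightarrow> real) \<Rightarrow> bool" where
  "bounded_lipschitz f \<longleftrightarrow>
     (\<exists>M. \<forall>t\<ge>0. \<bar>f t\<bar> \<le> M) \<and> (\<exists>K. \<forall>s\<ge>0. \<forall>t\<ge>0. \<bar>f s - f t\<bar> \<le> K * \<bar>s - t\<bar>)"

lemma bounded_lipschitzE:
  assumes "bounded_lipschitz f"
  obtains M K where "M > 0" "K > 0" "\<And>t. t \<ge> 0 \<Longrightarrow> \<bar>f t\<bar> \<le> M"
    "\<And>s t. s \<ge> 0 \<Longrightarrow> t \<ge> 0 \<Longrightarrow> \<bar>f s - f t\<bar> \<le> K * \<bar>s - t\<bar>"
proof -
  obtain M K where M: "\<And>t. t \<ge> 0 \<Longrightarrow> \<bar>f t\<bar> \<le> M"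
    and K: "\<And>s t. s \<ge> 0 \<Longrightarrow> t \<ge> 0 \<Longrightarrow> \<bar>f s - f t\<bar> \<le> K * \<bar>s - t\<bar>"
    using assms unfolding bounded_lipschitz_def by blast
  have "K * \<bar>s - t\<bar> \<le> (\<bar>K\<bar> + 1) * \<bar>s - t\<bar>" for s t :: real
    by (rule mult_right_mono) auto
  with K have "\<bar>f s - f t\<bar> \<le> (\<bar>K\<bar> + 1) * \<bar>s - t\<bar>" if "s \<ge> 0" "t \<ge> 0" for s t
    using that by (meson order_trans)
  moreover have "\<bar>f t\<bar> \<le> \<bar>M\<bar> + 1" if "t \<ge> 0" for t
    using M[OF that] by linarith
  ultimately show ?thesis
    using that[of "\<bar>M\<bar> + 1" "\<bar>K\<bar> + 1"] by simp
qed

lemma bounded_lipschitzI: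
  assumes "\<And>t. t \<ge> 0 \<Longrightarrow> \<bar>f t\<bar> \<le> M"
    "\<And>s t. s \<ge> 0 \<Longrightarrow> t \<ge> 0 \<Longrightarrow> \<bar>f s - f t\<bar> \<le> K * \<bar>s - t\<bar>"
  shows "bounded_lipschitz f"
  using assms unfolding bounded_lipschitz_def by blast

lemma bounded_lipschitz_const: "bounded_lipschitz (\<lambda>t. c)"
  by (rule bounded_lipschitzI[of _ "\<bar>c\<bar>" 0]) auto

lemma bounded_lipschitz_add:
  assumes "bounded_lipschitz f" "bounded_lipschitz g"
  shows "bounded_lipschitz (\<lambda>t. f t + g t)"
proof -
  from assms(1) obtain M K where f: "\<And>t. t \<ge> 0 \<Longrightarrow> \<bar>f t\<bar> \<le> M"
    "\<And>s t. s \<ge> 0 \<Longrightarrow> t \<ge> 0 \<Longrightarrow> \<bar>f s - f t\<bar> \<le> K * \<bar>s - t\<bar>"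
    by (elim bounded_lipschitzE) blast
  from assms(2) obtain M' K' where g: "\<And>t. t \<ge> 0 \<Longrightarrow> \<bar>g t\<bar> \<le> M'"
    "\<And>s t. s \<ge> 0 \<Longrightarrow> t \<ge> 0 \<Longrightarrow> \<bar>g s - g t\<bar> \<le> K' * \<bar>s - t\<bar>"
    by (elim bounded_lipschitzE) blast
  show ?thesis
  proof (rule bounded_lipschitzI[of _ "M + M'" "K + K'"])
    show "\<bar>f t + g t\<bar> \<le> M + M'" if "t \<ge> 0" for t
      using f(1)[OF that] g(1)[OF that] by linarith
    show "\<bar>f s + g s - (f t + g t)\<bar> \<le> (K + K') * \<bar>s - t\<bar>" if "s \<ge> 0" "t \<ge> 0" for s t
      using f(2)[OF that] g(2)[OF that] unfolding distrib_right by linarith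
  qed
qed

lemma bounded_lipschitz_mult:
  assumes "bounded_lipschitz f" "bounded_lipschitz g"
  shows "bounded_lipschitz (\<lambda>t. f t * g t)"
proof -
  from assms(1) obtain M K where f: "M > 0" "\<And>t. t \<ge> 0 \<Longrightarrow> \<bar>f t\<bar> \<le> M"
    "\<And>s t. s \<ge> 0 \<Longrightarrow> t \<ge> 0 \<Longrightarrow> \<bar>f s - f t\<bar> \<le> K * \<bar>s - t\<bar>"
    by (elim bounded_lipschitzE) blast
  from assms(2) obtain M' K' where g: "M' > 0" "\<And>t. t \<ge> 0 \<Longrightarrow> \<bar>g t\<bar> \<le> M'"
    "\<And>s t. s \<ge> 0 \<Longrightarrow> t \<ge> 0 \<Longrightarrow> \<bar>g s - g t\<bar> \<le> K' * \<bar>s - t\<bar>"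
    by (elim bounded_lipschitzE) blast
  show ?thesis
  proof (rule bounded_lipschitzI[of _ "M * M'" "M * K' + M' * K"])
    show "\<bar>f t * g t\<bar> \<le> M * M'" if "t \<ge> 0" for t
      unfolding abs_mult using f(1) f(2)[OF that] g(2)[OF that] by (intro mult_mono) auto
    show "\<bar>f s * g s - f t * g t\<bar> \<le> (M * K' + M' * K) * \<bar>s - t\<bar>" if "s \<ge> 0" "t \<ge> 0" for s t
    proof -
      have "f s * g s - f t * g t = f s * (g s - g t) + g t * (f s - f t)"
        by (simp add: algebra_simps)
      then have "\<bar>f s * g s - f t * g t\<bar> \<le> \<bar>f s\<bar> * \<bar>g s - g t\<bar> + \<bar>g t\<bar> * \<bar>f s - f t\<bar>"
        using abs_triangle_ineq[of "f s * (g s - g t)" "g t * (f s - f t)"] by (simp add: abs_mult)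
      also have "\<dots> \<le> M * (K' * \<bar>s - t\<bar>) + M' * (K * \<bar>s - t\<bar>)"
        by (intro add_mono mult_mono f(2) g(2) f(3) g(3) that abs_ge_zero less_imp_le[OF f(1)] less_imp_le[OF g(1)])
      finally show ?thesis by (simp add: algebra_simps)
    qed
  qed
qed

lemma bounded_lipschitz_diff:
  assumes "bounded_lipschitz f" "bounded_lipschitz g"
  shows "bounded_lipschitz (\<lambda>t. f t - g t)"
  using bounded_lipschitz_add[OF assms(1) bounded_lipschitz_mult[OF bounded_lipschitz_const assms(2)], of "-1"]
  by simp

lemma bounded_lipschitz_sum:
  assumes "\<And>x. x \<in> A \<Longrightarrow> bounded_lipschitz (f x)"
  shows "bounded_lipschitz (\<lambda>t. \<Sum>x\<in>A. f x t)"
  using assms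
  by (induction A rule: infinite_finite_induct)
    (auto intro: bounded_lipschitz_const bounded_lipschitz_add)

lemma bounded_lipschitz_inverse:
  assumes "bounded_lipschitz f" "m > 0" "\<And>t. t \<ge> 0 \<Longrightarrow> m \<le> f t"
  shows "bounded_lipschitz (\<lambda>t. inverse (f t))"
proof -
  from assms(1) obtain K where K: "K > 0"
    "\<And>s t. s \<ge> 0 \<Longrightarrow> t \<ge> 0 \<Longrightarrow> \<bar>f s - f t\<bar> \<le> K * \<bar>s - t\<bar>"
    by (elim bounded_lipschitzE) blast
  have inv: "0 < inverse (f t) \<and> inverse (f t) \<le> inverse m" if "t \<ge> 0" for t
    using assms(2) assms(3)[OF that] by (auto intro: le_imp_inverse_le)
  show ?thesis
  proof (rule bounded_lipschitzI[of _ "inverse m" "inverse m * inverse m * K"])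
    show "\<bar>inverse (f t)\<bar> \<le> inverse m" if "t \<ge> 0" for t
      using inv[OF that] by simp
    show "\<bar>inverse (f s) - inverse (f t)\<bar> \<le> inverse m * inverse m * K * \<bar>s - t\<bar>"
      if "s \<ge> 0" "t \<ge> 0" for s t
    proof -
      have "f s \<noteq> 0" "f t \<noteq> 0" using inv that by force+
      then have "inverse (f s) - inverse (f t) = - (inverse (f s) * inverse (f t) * (f s - f t))"
        by (simp add: field_simps)
      then have "\<bar>inverse (f s) - inverse (f t)\<bar> = inverse (f s) * inverse (f t) * \<bar>f s - f t\<bar>"
        using inv[OF that(1)] inv[OF that(2)] by (simp add: abs_mult)
      also have "\<dots> \<le> inverse m * inverse m * (K * \<bar>s - t\<bar>)"
        using inv[OF that(1)] inv[OF that(2)] K(2)[OF that] assms(2) by (intro mult_mono) auto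
      finally show ?thesis by (simp add: mult.assoc)
    qed
  qed
qed

lemma bounded_lipschitz_of_derivative:
  assumes der: "\<And>t. t \<ge> 0 \<Longrightarrow> (f has_real_derivative f' t) (at t within {0..})"
    and "bounded (f ` {0..})" "bounded (f' ` {0..})"
  shows "bounded_lipschitz f"
proof -
  obtain M K where M: "\<And>t. t \<ge> 0 \<Longrightarrow> \<bar>f t\<bar> \<le> M" and K: "\<And>t. t \<ge> 0 \<Longrightarrow> \<bar>f' t\<bar> \<le> K"
    using assms(2,3) unfolding bounded_iff by auto
  show ?thesis
  proof (rule bounded_lipschitzI)
    show "\<bar>f t\<bar> \<le> M" if "t \<ge> 0" for t by (fact M[OF that])
    show "\<bar>f s - f t\<bar> \<le> K * \<bar>s - t\<bar>" if "s \<ge> 0" "t \<ge> 0" for s t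
      using field_differentiable_bound[of "{0..}" f f' K s t] der K that by auto
  qed
qed

lemma bounded_mult_image:
  fixes f g :: "'a \<Rightarrow> real"
  assumes "bounded (f ` A)" "bounded (g ` A)"
  shows "bounded ((\<lambda>x. f x * g x) ` A)"
proof -
  obtain M M' where "\<forall>x\<in>A. \<bar>f x\<bar> \<le> M" "\<forall>x\<in>A. \<bar>g x\<bar> \<le> M'"
    using assms unfolding bounded_iff by auto
  then have "\<forall>x\<in>A. \<bar>f x * g x\<bar> \<le> M * M'"
    unfolding abs_mult by (meson abs_ge_zero mult_mono order_trans)
  then show ?thesis unfolding bounded_iff by auto
qed

lemma bounded_sum_image:
  fixes f :: "'i \<Rightarrow> 'a \<Rightarrow> real"
  assumes "\<And>i. i \<in> J \<Longrightarrow> bounded (f i ` A)"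
  shows "bounded ((\<lambda>x. \<Sum>i\<in>J. f i x) ` A)"
  using assms
  by (induction J rule: infinite_finite_induct) (auto intro: bounded_plus_comp simp: image_constant_conv)

lemma nonincreasing_bounded_below_tendsto:
  fixes f :: "real \<Rightarrow> real"
  assumes mono: "\<And>s t. 0 \<le> s \<Longrightarrow> s \<le> t \<Longrightarrow> f t \<le> f s" and bound: "\<And>t. 0 \<le> t \<Longrightarrow> b \<le> f t"
  obtains l where "(f \<longlongrightarrow> l) at_top"
proof (rule that)
  have bdd: "bdd_below (f ` {0..})" using bound by (intro bdd_belowI2) auto
  show "(f \<longlongrightarrow> Inf (f ` {0..})) at_top"
  proof (rule decreasing_tendsto)
    show "\<forall>\<^sub>F t in at_top. Inf (f ` {0..}) \<le> f t"
      using eventually_ge_at_top[of 0] by eventually_elim (auto intro: cInf_lower bdd)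
    fix y assume "Inf (f ` {0..}) < y"
    then obtain t0 where "t0 \<ge> 0" "f t0 < y"
      using cInf_less_iff[OF _ bdd] by auto
    then show "\<forall>\<^sub>F t in at_top. f t < y"
      using mono by (auto intro: eventually_mono[OF eventually_ge_at_top[of t0]] le_less_trans)
  qed
qed

lemma at_within_nonneg:
  fixes t :: real
  assumes "t > 0"
  shows "at t within {0..} = at t"
  by (rule at_within_interior) (use assms in simp)

text \<open>Barbalat's lemma. By the mean value theorem \<open>f' t\<close> is within \<open>K \<delta>\<close> of the difference quotient
  \<open>(f (t + \<delta>) - f t) / \<delta>\<close>, which tends to \<open>0\<close> for each fixed \<open>\<delta>\<close>.\<close>

lemma derivative_tendsto_zero:
  assumes der: "\<And>t. t \<ge> 0 \<Longrightarrow> (f has_real_derivative f' t) (at t within {0..})"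
    and lim: "(f \<longlongrightarrow> l) at_top" and "bounded_lipschitz f'"
  shows "(f' \<longlongrightarrow> 0) at_top"
proof (rule tendstoI)
  fix e :: real assume "e > 0"
  from \<open>bounded_lipschitz f'\<close> obtain K where K: "K > 0"
    "\<And>s t. s \<ge> 0 \<Longrightarrow> t \<ge> 0 \<Longrightarrow> \<bar>f' s - f' t\<bar> \<le> K * \<bar>s - t\<bar>"
    by (elim bounded_lipschitzE) blast
  define d where "d = e / (2 * K)"
  have "d > 0" using \<open>e > 0\<close> K by (simp add: d_def)
  have "filterlim (\<lambda>t. d + t) at_top at_top"
    by (rule filterlim_tendsto_add_at_top[OF tendsto_const filterlim_ident])
  from tendsto_diff[OF filterlim_compose[OF lim this] lim]
  have "((\<lambda>t. f (d + t) - f t) \<longlongrightarrow> 0) at_top" by simp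
  moreover have "d * (e / 2) > 0" using \<open>d > 0\<close> \<open>e > 0\<close> by simp
  ultimately have "\<forall>\<^sub>F t in at_top. dist (f (d + t) - f t) 0 < d * (e / 2)"
    by (rule tendstoD)
  then show "\<forall>\<^sub>F t in at_top. dist (f' t) 0 < e"
    using eventually_gt_at_top[of 0]
  proof eventually_elim
    case (elim t)
    have "\<exists>z>t. z < d + t \<and> f (d + t) - f t = (d + t - t) * f' z"
    proof (rule MVT2)
      show "t < d + t" using \<open>d > 0\<close> by simp
      fix x assume "t \<le> x" "x \<le> d + t"
      have "x > 0" using elim(2) \<open>t \<le> x\<close> by linarith
      with der[of x] show "(f has_real_derivative f' x) (at x)" by (simp add: at_within_nonneg)
    qed
    then obtain z where z: "t < z" "z < d + t" "f (d + t) - f t = d * f' z" by auto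
    have "d * \<bar>f' z\<bar> < d * (e / 2)"
      using elim(1) z(3) \<open>d > 0\<close> by (simp add: abs_mult)
    then have "\<bar>f' z\<bar> < e / 2" using \<open>d > 0\<close> by simp
    moreover have "\<bar>f' t - f' z\<bar> \<le> K * \<bar>t - z\<bar>" using elim(2) z(1) by (intro K(2)) auto
    moreover have "K * \<bar>t - z\<bar> \<le> K * d" using K z by (intro mult_left_mono) auto
    moreover have "K * d = e / 2" using K by (simp add: d_def)
    ultimately show ?case by simp
  qed
qed

section \<open>Volterra functions and the graph Laplacian\<close>

lemma positive_of_linear_lower_bound:
  fixes f :: "real \<Rightarrow> real"
  assumes "T \<ge> 0" "f 0 > 0" "continuous_on {0..T} f"
    and der: "\<And>t. 0 < t \<Longrightarrow> t < T \<Longrightarrow> (f has_real_derivative f' t) (at t)"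
    and bound: "\<And>t. 0 < t \<Longrightarrow> t < T \<Longrightarrow> - K * f t \<le> f' t"
  shows "f T > 0"
proof -
  have "exp (K * 0) * f 0 \<le> exp (K * T) * f T"
  proof (rule DERIV_nonneg_imp_increasing_open[where f = "\<lambda>t. exp (K * t) * f t"])
    show "0 \<le> T" by fact
    show "continuous_on {0..T} (\<lambda>t. exp (K * t) * f t)"
      by (intro continuous_intros assms)
    fix t assume t: "0 < t" "t < T"
    have "((\<lambda>t. exp (K * t) * f t) has_real_derivative exp (K * t) * (K * f t + f' t)) (at t)"
      by (auto intro!: derivative_eq_intros der t simp: algebra_simps)
    moreover have "exp (K * t) * (K * f t + f' t) \<ge> 0" using bound[OF t] by simp
    ultimately show "\<exists>y. ((\<lambda>t. exp (K * t) * f t) has_real_derivative y) (at t) \<and> y \<ge> 0" by blast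
  qed
  with \<open>f 0 > 0\<close> have "exp (K * T) * f T > 0" by simp
  then show ?thesis by (simp add: zero_less_mult_iff)
qed

definition volterra :: "real \<Rightarrow> real \<Rightarrow> real" where
  "volterra a z = z - a - a * ln (z / a)"

lemma volterra_nonneg:
  assumes "a > 0" "z > 0"
  shows "volterra a z \<ge> 0"
proof -
  have "a * ln (z / a) \<le> a * (z / a - 1)"
    using assms by (intro mult_left_mono ln_le_minus_one) auto
  then show ?thesis using assms by (simp add: volterra_def algebra_simps)
qed

lemma volterra_has_derivative:
  assumes "a > 0" "f t > 0" "(f has_real_derivative d) (at t within A)"
  shows "((\<lambda>s. volterra a (f s)) has_real_derivative (1 - a / f t) * d) (at t within A)"
  unfolding volterra_def using assms
  by (auto intro!: derivative_eq_intros simp: field_simps)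

lemma volterra_sublevel_bounds:
  assumes "a > 0"
  obtains m M where "m > 0" "\<And>z. z > 0 \<Longrightarrow> volterra a z \<le> C \<Longrightarrow> m \<le> z \<and> z \<le> M"
proof (rule that)
  show "a * exp (- (C + a) / a) > 0" using assms by simp
  fix z :: real assume z: "z > 0" "volterra a z \<le> C"
  have "- (C + a) \<le> a * ln (z / a)" using z by (simp add: volterra_def)
  then have "- (C + a) / a \<le> ln (z / a)" using assms by (simp add: field_simps)
  then have "exp (- (C + a) / a) \<le> z / a"
    using z assms by (metis divide_pos_pos exp_le_cancel_iff exp_ln)
  then have "a * exp (- (C + a) / a) \<le> z" using assms by (simp add: field_simps)
  moreover have "z \<le> 2 * (C + a * ln 2)"
  proof -
    have "ln (z / a) = ln (z / (2 * a)) + ln 2"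
      using z assms by (simp add: ln_div ln_mult)
    also have "\<dots> \<le> z / (2 * a) - 1 + ln 2"
      using z assms by (intro add_right_mono ln_le_minus_one) auto
    finally have "a * ln (z / a) \<le> a * (z / (2 * a) - 1 + ln 2)"
      using assms by (intro mult_left_mono) auto
    also have "\<dots> = z / 2 - a + a * ln 2" using assms by (simp add: field_simps)
    finally show ?thesis using z(2) by (simp add: volterra_def)
  qed
  ultimately show "a * exp (- (C + a) / a) \<le> z \<and> z \<le> 2 * (C + a * ln 2)" ..
qed

lemma graph_laplacian_eq_sum_UNIV:
  assumes "weighted_graph w"
  shows "graph_laplacian w F x = (\<Sum>y\<in>UNIV. w x y * (F y - F x))"
proof -
  have "w x y = 0" if "\<not> 0 < w x y" for y
    using assms that unfolding weighted_graph_def by (meson antisym not_less)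
  then show ?thesis unfolding graph_laplacian_def
    by (intro sum.mono_neutral_left) auto
qed

lemma graph_laplacian_ge:
  assumes "weighted_graph w" "\<And>y. 0 \<le> F y"
  shows "- (\<Sum>y\<in>UNIV. w x y) * F x \<le> graph_laplacian w F x"
proof -
  have "0 \<le> (\<Sum>y\<in>UNIV. w x y * F y)"
    using assms unfolding weighted_graph_def by (intro sum_nonneg mult_nonneg_nonneg) auto
  then show ?thesis
    by (simp add: graph_laplacian_eq_sum_UNIV[OF assms(1)] right_diff_distrib sum_subtractf sum_distrib_right)
qed

lemma sum_volterra_laplacian_nonpos:
  assumes g: "weighted_graph w" and "a \<ge> 0" and F: "\<And>x. F x > 0"
  shows "(\<Sum>x\<in>UNIV. (1 - a / F x) * graph_laplacian w F x) \<le> 0"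
proof -
  let ?q = "\<lambda>x y. (1 - a / F x) * (w x y * (F y - F x))"
  have sym: "w x y = w y x" and nn: "0 \<le> w x y" for x y
    using g unfolding weighted_graph_def by auto
  have "?q x y + ?q y x \<le> 0" for x y
  proof -
    have "?q x y + ?q y x = - (w x y * a * ((F y - F x)\<^sup>2 / (F x * F y)))"
      using F[of x] F[of y] sym[of y x] by (simp add: field_simps power2_eq_square)
    also have "\<dots> \<le> 0" using nn[of x y] F[of x] F[of y] \<open>a \<ge> 0\<close> by simp
    finally show ?thesis .
  qed
  then have "(\<Sum>x\<in>UNIV. \<Sum>y\<in>UNIV. ?q x y + ?q y x) \<le> 0"
    by (intro sum_nonpos)
  moreover have "(\<Sum>x\<in>UNIV. \<Sum>y\<in>UNIV. ?q x y) = (\<Sum>x\<in>UNIV. \<Sum>y\<in>UNIV. ?q y x)"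
    by (rule sum.swap)
  ultimately have "(\<Sum>x\<in>UNIV. \<Sum>y\<in>UNIV. ?q x y) \<le> 0"
    unfolding sum.distrib by linarith
  then show ?thesis
    by (simp add: graph_laplacian_eq_sum_UNIV[OF g] sum_distrib_left)
qed

text \<open>The hypotheses say that \<open>c, d, b, a, A, B\<close> are flows balanced at two nodes with potentials
  \<open>ln s\<close> and \<open>ln v\<close>, so the logarithms in \<open>1 - z \<le> - ln z\<close> cancel in the sum.  The quadratic terms come
  from \<open>(1 / s - 1 - ln (1 / s)) + (s - 1 - ln s) = (s - 1)\<^sup>2 / s\<close>.\<close>

lemma balanced_flow_dissipation:
  fixes s v :: real
  assumes "s > 0" "v > 0" "0 \<le> a" "0 \<le> b"
    and k: "0 \<le> k" "k \<le> c" "k \<le> d" "k \<le> A" "k \<le> B"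
    and bal: "c + b = A + a" "d + a = B + b"
  shows "c * (1 - 1 / s) + d * (1 - 1 / v) + b * (1 - v / s) + a * (1 - s / v)
           - A * (s - 1) - B * (v - 1)
         \<le> - k * ((s - 1)\<^sup>2 / s) - k * ((v - 1)\<^sup>2 / v)"
proof -
  define \<phi> :: "real \<Rightarrow> real" where "\<phi> z = z - 1 - ln z" for z
  have \<phi>: "\<phi> z \<ge> 0" if "z > 0" for z
    using ln_le_minus_one[OF that] by (simp add: \<phi>_def)
  have sym: "\<phi> (1 / z) + \<phi> z = (z - 1)\<^sup>2 / z" if "z > 0" for z
    using that by (simp add: \<phi>_def ln_div field_simps power2_eq_square)
  have "c * (1 - 1 / s) + d * (1 - 1 / v) + b * (1 - v / s) + a * (1 - s / v)
           - A * (s - 1) - B * (v - 1)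
      = - c * \<phi> (1 / s) - d * \<phi> (1 / v) - b * \<phi> (v / s) - a * \<phi> (s / v) - A * \<phi> s - B * \<phi> v
        + (c + b - (A + a)) * ln s + (d + a - (B + b)) * ln v"
    using assms(1,2) by (simp add: \<phi>_def ln_div algebra_simps)
  also have "\<dots> = - c * \<phi> (1 / s) - d * \<phi> (1 / v) - b * \<phi> (v / s) - a * \<phi> (s / v) - A * \<phi> s - B * \<phi> v"
    using bal by simp
  also have "\<dots> \<le> - k * \<phi> (1 / s) - k * \<phi> (1 / v) - 0 - 0 - k * \<phi> s - k * \<phi> v"
    using assms \<phi>[of s] \<phi>[of v] \<phi>[of "1/s"] \<phi>[of "1/v"] \<phi>[of "v/s"] \<phi>[of "s/v"]
    by (intro diff_mono) (auto intro: mult_right_mono)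
  also have "\<dots> = - k * (\<phi> (1 / s) + \<phi> s) - k * (\<phi> (1 / v) + \<phi> v)"
    by (simp add: algebra_simps)
  finally show ?thesis using sym assms(1,2) by simp
qed

section \<open>The networked SVIRS system\<close>

locale svirs =
  fixes w :: "'v::finite \<Rightarrow> 'v \<Rightarrow> real"
    and \<epsilon> N r \<mu> \<beta> p \<xi> \<sigma> \<gamma> Ss Vs Is :: real
    and S V I :: "'v \<Rightarrow> real \<Rightarrow> real"
  assumes graph: "weighted_graph w"
    and N: "0 < N" and r: "0 < r" "r < 1" and mu: "0 < \<mu>" and beta: "0 < \<beta>"
    and p: "0 \<le> p" and sigma: "0 \<le> \<sigma>" and eps: "0 < \<epsilon>" and xi: "0 \<le> \<xi>"
    and eq: "svirs_equilibrium N r \<mu> \<beta> p \<xi> \<sigma> \<gamma> 0 Ss Vs Is"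
    and eqpos: "0 < Ss" "0 < Vs" "0 < Is"
    and sol: "svirs_solution w \<epsilon> N r \<mu> \<beta> p \<xi> \<sigma> \<gamma> 0 S V I"
    and init: "0 < S x 0" "0 < V x 0" "0 < I x 0"
begin

definition dS :: "'v \<Rightarrow> real \<Rightarrow> real" where
  "dS x t = \<epsilon> * graph_laplacian w (\<lambda>y. S y t) x
     + (\<mu> * (1 - r) * N - (\<mu> + p) * S x t - \<beta> * S x t * I x t + \<xi> * V x t)"

definition dV :: "'v \<Rightarrow> real \<Rightarrow> real" where
  "dV x t = \<epsilon> * graph_laplacian w (\<lambda>y. V y t) x
     + (\<mu> * r * N + p * S x t - \<beta> * \<sigma> * V x t * I x t - (\<mu> + \<xi>) * V x t)"

definition dI :: "'v \<Rightarrow> real \<Rightarrow> real" where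
  "dI x t = \<epsilon> * graph_laplacian w (\<lambda>y. I y t) x
     + (\<beta> * S x t * I x t + \<beta> * \<sigma> * V x t * I x t - (\<mu> + \<gamma>) * I x t)"

lemma has_derivative_within:
  assumes "t \<ge> 0"
  shows "(S x has_real_derivative dS x t) (at t within {0..})"
    and "(V x has_real_derivative dV x t) (at t within {0..})"
    and "(I x has_real_derivative dI x t) (at t within {0..})"
proof -
  note der = sol[unfolded svirs_solution_def, rule_format, OF assms, of x]
  show "(S x has_real_derivative dS x t) (at t within {0..})"
    by (rule DERIV_cong[OF der[THEN conjunct1]]) (simp add: dS_def)
  show "(V x has_real_derivative dV x t) (at t within {0..})"
    by (rule DERIV_cong[OF der[THEN conjunct2, THEN conjunct1]]) (simp add: dV_def)
  show "(I x has_real_derivative dI x t) (at t within {0..})"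
    by (rule DERIV_cong[OF der[THEN conjunct2, THEN conjunct2]]) (simp add: dI_def)
qed

lemma has_derivative_at:
  assumes "t > 0"
  shows "(S x has_real_derivative dS x t) (at t)"
    and "(V x has_real_derivative dV x t) (at t)"
    and "(I x has_real_derivative dI x t) (at t)"
  using has_derivative_within[of t x] assms unfolding at_within_nonneg[OF assms] by auto

lemma continuous_on_nonneg:
  assumes "A \<subseteq> {0..}"
  shows "continuous_on A (S x)" "continuous_on A (V x)" "continuous_on A (I x)"
proof -
  have "continuous_on {0..} (S x)" "continuous_on {0..} (V x)" "continuous_on {0..} (I x)"
    by (rule DERIV_continuous_on, rule has_derivative_within, simp)+
  then show "continuous_on A (S x)" "continuous_on A (V x)" "continuous_on A (I x)"
    using assms continuous_on_subset by blast+
qed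

lemma positive_step:
  assumes "T \<ge> 0" and pos: "\<And>t x. 0 \<le> t \<Longrightarrow> t < T \<Longrightarrow> 0 < S x t \<and> 0 < V x t \<and> 0 < I x t"
  shows "0 < S x T" "0 < V x T" "0 < I x T"
proof -
  define D where "D = \<epsilon> * (\<Sum>y\<in>UNIV. w x y)"
  have lap: "- D * F x \<le> \<epsilon> * graph_laplacian w F x" if "\<And>y. 0 < F y" for F
    using mult_left_mono[OF graph_laplacian_ge[OF graph, of F x], of \<epsilon>] that eps
    by (auto simp: D_def mult.assoc less_imp_le)
  have "bounded (I x ` {0..T})"
    by (intro compact_imp_bounded compact_continuous_image continuous_on_nonneg) auto
  then obtain M where "\<forall>y\<in>I x ` {0..T}. norm y \<le> M"
    unfolding bounded_iff by blast
  then have M: "I x t \<le> M" if "0 \<le> t" "t \<le> T" for t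
    using that by (simp add: abs_le_iff)
  have N1: "\<mu> * (1 - r) * N > 0" "\<mu> * r * N > 0" using mu r N by simp_all
  show "0 < S x T"
  proof (rule positive_of_linear_lower_bound[where f = "S x" and f' = "dS x" and K = "D + \<mu> + p + \<beta> * M"])
    fix t assume t: "0 < t" "t < T"
    note q = pos[of t] M[of t]
    show "- (D + \<mu> + p + \<beta> * M) * S x t \<le> dS x t"
    proof -
      have "\<beta> * S x t * I x t \<le> \<beta> * S x t * M" "0 \<le> \<xi> * V x t"
        using q t beta xi by (auto intro!: mult_left_mono simp: less_imp_le)
      then show ?thesis using lap[of "\<lambda>y. S y t"] q t N1 unfolding dS_def
        by (simp add: algebra_simps)
    qed
  qed (use \<open>T \<ge> 0\<close> init has_derivative_at(1) continuous_on_nonneg(1) in auto)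
  show "0 < V x T"
  proof (rule positive_of_linear_lower_bound[where f = "V x" and f' = "dV x" and K = "D + \<mu> + \<xi> + \<beta> * \<sigma> * M"])
    fix t assume t: "0 < t" "t < T"
    note q = pos[of t] M[of t]
    show "- (D + \<mu> + \<xi> + \<beta> * \<sigma> * M) * V x t \<le> dV x t"
    proof -
      have "\<beta> * \<sigma> * V x t * I x t \<le> \<beta> * \<sigma> * V x t * M" "0 \<le> p * S x t"
        using q t beta sigma p by (auto intro!: mult_left_mono simp: less_imp_le)
      then show ?thesis using lap[of "\<lambda>y. V y t"] q t N1 unfolding dV_def
        by (simp add: algebra_simps)
    qed
  qed (use \<open>T \<ge> 0\<close> init has_derivative_at(2) continuous_on_nonneg(2) in auto)
  show "0 < I x T"
  proof (rule positive_of_linear_lower_bound[where f = "I x" and f' = "dI x" and K = "D + \<mu> + \<gamma>"])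
    fix t assume t: "0 < t" "t < T"
    note q = pos[of t]
    show "- (D + \<mu> + \<gamma>) * I x t \<le> dI x t"
    proof -
      have "0 \<le> \<beta> * S x t * I x t" "0 \<le> \<beta> * \<sigma> * V x t * I x t"
        using q t beta sigma by (auto simp: less_imp_le)
      then show ?thesis using lap[of "\<lambda>y. I y t"] q t unfolding dI_def
        by (simp add: algebra_simps)
    qed
  qed (use \<open>T \<ge> 0\<close> init has_derivative_at(3) continuous_on_nonneg(3) in auto)
qed

lemma positive:
  assumes "t \<ge> 0"
  shows "0 < S x t \<and> 0 < V x t \<and> 0 < I x t"
proof (rule ccontr)
  assume neg: "\<not> ?thesis"
  define Z where "Z = (\<Union>x. {s \<in> {0..t}. S x s \<le> 0} \<union> {s \<in> {0..t}. V x s \<le> 0} \<union> {s \<in> {0..t}. I x s \<le> 0})"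
  have "closed Z" unfolding Z_def
    by (intro closed_UN closed_Un ballI continuous_on_closed_Collect_le continuous_on_const
        continuous_on_nonneg) auto
  moreover have "Z \<subseteq> {0..t}" by (auto simp: Z_def)
  ultimately have "compact Z"
    by (meson compact_Icc compact_Int_closed compact_eq_bounded_closed bounded_subset)
  moreover have "t \<in> Z" using neg assms by (auto simp: Z_def not_less)
  ultimately obtain T where T: "T \<in> Z" "\<And>s. s \<in> Z \<Longrightarrow> T \<le> s"
    using compact_attains_inf[of Z] by blast
  have T0: "0 \<le> T" "T \<le> t" using \<open>Z \<subseteq> {0..t}\<close> T(1) by auto
  have before: "0 < S y s \<and> 0 < V y s \<and> 0 < I y s" if "0 \<le> s" "s < T" for s y
    using T(2)[of s] that T0 unfolding Z_def by (auto simp flip: not_le)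
  note at_T = positive_step[OF T0(1) before]
  from T(1) obtain y where "S y T \<le> 0 \<or> V y T \<le> 0 \<or> I y T \<le> 0" by (auto simp: Z_def)
  with at_T(1)[of y] at_T(2)[of y] at_T(3)[of y] show False by linarith
qed

definition lyap :: "real \<Rightarrow> real" where
  "lyap t = (\<Sum>x\<in>UNIV. volterra Ss (S x t) + volterra Vs (V x t) + volterra Is (I x t))"

definition dlyap :: "real \<Rightarrow> real" where
  "dlyap t = (\<Sum>x\<in>UNIV. (1 - Ss / S x t) * dS x t + (1 - Vs / V x t) * dV x t + (1 - Is / I x t) * dI x t)"

lemma lyap_has_derivative:
  assumes "t \<ge> 0"
  shows "(lyap has_real_derivative dlyap t) (at t within {0..})"
  unfolding lyap_def[abs_def] dlyap_def
  using positive[OF assms] has_derivative_within[OF assms] eqpos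
  by (intro DERIV_sum DERIV_add volterra_has_derivative) auto

definition rate :: real where
  "rate = Min {\<mu> * (1 - r) * N, \<mu> * r * N, \<mu> * Ss + \<beta> * Ss * Is, \<mu> * Vs + \<beta> * \<sigma> * Vs * Is}"

lemma rate_pos: "rate > 0"
  using N r mu beta sigma eqpos by (auto simp: rate_def intro!: add_pos_nonneg)

lemma reaction_dissipation:
  assumes "u > 0" "v > 0" "z > 0"
  shows "(1 - Ss / u) * (\<mu> * (1 - r) * N - (\<mu> + p) * u - \<beta> * u * z + \<xi> * v)
       + (1 - Vs / v) * (\<mu> * r * N + p * u - \<beta> * \<sigma> * v * z - (\<mu> + \<xi>) * v)
       + (1 - Is / z) * (\<beta> * u * z + \<beta> * \<sigma> * v * z - (\<mu> + \<gamma>) * z)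
    \<le> - rate * ((u / Ss - 1)\<^sup>2 / (u / Ss)) - rate * ((v / Vs - 1)\<^sup>2 / (v / Vs))"
    (is "?L \<le> _")
proof -
  define c d where "c = \<mu> * (1 - r) * N" and "d = \<mu> * r * N"
  define a b where "a = p * Ss" and "b = \<xi> * Vs"
  define A B where "A = \<mu> * Ss + \<beta> * Ss * Is" and "B = \<mu> * Vs + \<beta> * \<sigma> * Vs * Is"
  define s1 v1 where "s1 = u / Ss" and "v1 = v / Vs"
  have sv: "s1 > 0" "v1 > 0" "u = Ss * s1" "v = Vs * v1"
    using assms eqpos by (auto simp: s1_def v1_def)
  have bal: "c + b = A + a" "d + a = B + b" and g: "\<mu> + \<gamma> = \<beta> * Ss + \<beta> * \<sigma> * Vs"
    using eq unfolding svirs_equilibrium_def c_def d_def a_def b_def A_def B_def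
    by (simp_all add: algebra_simps)
  have "?L = c * (1 - 1 / s1) + d * (1 - 1 / v1) + b * (1 - v1 / s1) + a * (1 - s1 / v1)
           - A * (s1 - 1) - B * (v1 - 1)"
  proof -
    have "(1 - Is / z) * (\<beta> * u * z + \<beta> * \<sigma> * v * z - (\<mu> + \<gamma>) * z)
        = (z - Is) * (\<beta> * Ss * (s1 - 1) + \<beta> * \<sigma> * Vs * (v1 - 1))"
      unfolding g sv(3,4) using assms(3) by (simp add: field_simps)
    moreover have "(1 - Ss / u) * (\<mu> * (1 - r) * N - (\<mu> + p) * u - \<beta> * u * z + \<xi> * v)
        = c * (1 - 1 / s1) + b * v1 - b * (v1 / s1) - (\<mu> * Ss + a + \<beta> * Ss * z) * (s1 - 1)"
      unfolding c_def[symmetric] sv(3,4) a_def b_def using sv(1) eqpos by (simp add: field_simps)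
    moreover have "(1 - Vs / v) * (\<mu> * r * N + p * u - \<beta> * \<sigma> * v * z - (\<mu> + \<xi>) * v)
        = d * (1 - 1 / v1) + a * s1 - a * (s1 / v1) - (\<mu> * Vs + b + \<beta> * \<sigma> * Vs * z) * (v1 - 1)"
      unfolding d_def[symmetric] sv(3,4) a_def b_def using sv(2) eqpos by (simp add: field_simps)
    ultimately show ?thesis unfolding A_def B_def by (simp add: algebra_simps)
  qed
  also have "\<dots> \<le> - rate * ((s1 - 1)\<^sup>2 / s1) - rate * ((v1 - 1)\<^sup>2 / v1)"
  proof (rule balanced_flow_dissipation)
    show "0 \<le> a" "0 \<le> b" using p xi eqpos by (auto simp: a_def b_def)
    show "rate \<le> c" "rate \<le> d" "rate \<le> A" "rate \<le> B"
      by (auto simp: rate_def c_def d_def A_def B_def)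
  qed (use sv bal rate_pos in auto)
  finally show ?thesis by (simp add: s1_def v1_def)
qed

lemma dlyap_le:
  assumes "t \<ge> 0"
  shows "dlyap t \<le> - rate * (\<Sum>x\<in>UNIV. (S x t / Ss - 1)\<^sup>2 / (S x t / Ss) + (V x t / Vs - 1)\<^sup>2 / (V x t / Vs))"
proof -
  note pos = positive[OF assms]
  let ?lap = "\<lambda>a F. (\<Sum>x\<in>UNIV. (1 - a / F x t) * graph_laplacian w (\<lambda>y. F y t) x)"
  let ?reac = "\<lambda>x. (1 - Ss / S x t) * (\<mu> * (1 - r) * N - (\<mu> + p) * S x t - \<beta> * S x t * I x t + \<xi> * V x t)
       + (1 - Vs / V x t) * (\<mu> * r * N + p * S x t - \<beta> * \<sigma> * V x t * I x t - (\<mu> + \<xi>) * V x t)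
       + (1 - Is / I x t) * (\<beta> * S x t * I x t + \<beta> * \<sigma> * V x t * I x t - (\<mu> + \<gamma>) * I x t)"
  have expand: "a1 * (\<epsilon> * l1 + q1) + a2 * (\<epsilon> * l2 + q2) + a3 * (\<epsilon> * l3 + q3)
      = \<epsilon> * (a1 * l1 + a2 * l2 + a3 * l3) + (a1 * q1 + a2 * q2 + a3 * q3)"
    for a1 a2 a3 l1 l2 l3 q1 q2 q3 :: real
    by (simp add: algebra_simps)
  have "dlyap t = \<epsilon> * (?lap Ss S + ?lap Vs V + ?lap Is I) + (\<Sum>x\<in>UNIV. ?reac x)"
    unfolding dlyap_def dS_def dV_def dI_def expand
    by (simp only: sum.distrib sum_distrib_left distrib_left)
  also have "\<dots> \<le> \<epsilon> * 0 + (\<Sum>x\<in>UNIV. - rate * ((S x t / Ss - 1)\<^sup>2 / (S x t / Ss)) - rate * ((V x t / Vs - 1)\<^sup>2 / (V x t / Vs)))"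
  proof (intro add_mono mult_left_mono sum_mono reaction_dissipation)
    have "?lap Ss S \<le> 0" "?lap Vs V \<le> 0" "?lap Is I \<le> 0"
      using pos eqpos graph by (intro sum_volterra_laplacian_nonpos; simp)+
    then show "?lap Ss S + ?lap Vs V + ?lap Is I \<le> 0" by linarith
  qed (use pos eps in auto)
  also have "\<dots> = - rate * (\<Sum>x\<in>UNIV. (S x t / Ss - 1)\<^sup>2 / (S x t / Ss) + (V x t / Vs - 1)\<^sup>2 / (V x t / Vs))"
    unfolding sum_distrib_left by (simp add: algebra_simps)
  finally show ?thesis .
qed

lemma quotient_squares_le:
  assumes "t \<ge> 0"
  shows "(S x t / Ss - 1)\<^sup>2 / (S x t / Ss) \<le> - dlyap t / rate"
    and "(V x t / Vs - 1)\<^sup>2 / (V x t / Vs) \<le> - dlyap t / rate"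
proof -
  let ?f = "\<lambda>x. (S x t / Ss - 1)\<^sup>2 / (S x t / Ss)" and ?g = "\<lambda>x. (V x t / Vs - 1)\<^sup>2 / (V x t / Vs)"
  have nn: "0 \<le> ?f y" "0 \<le> ?g y" for y using positive[OF assms, of y] eqpos by auto
  have "?f x + ?g x \<le> (\<Sum>y\<in>UNIV. ?f y + ?g y)"
    using nn by (intro member_le_sum) auto
  also have "\<dots> \<le> - dlyap t / rate"
    using dlyap_le[OF assms] rate_pos by (simp add: field_simps)
  finally show "?f x \<le> - dlyap t / rate" "?g x \<le> - dlyap t / rate"
    using nn[of x] by linarith+
qed

lemma dlyap_nonpos:
  assumes "t \<ge> 0"
  shows "dlyap t \<le> 0"
proof -
  have "0 \<le> (S undefined t / Ss - 1)\<^sup>2 / (S undefined t / Ss)"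
    using positive[OF assms, of undefined] eqpos by auto
  then have "0 \<le> - dlyap t / rate" using quotient_squares_le(1)[OF assms] by (rule order_trans)
  then show ?thesis using rate_pos by (simp add: field_simps)
qed

lemma lyap_antimono:
  assumes "0 \<le> s" "s \<le> t"
  shows "lyap t \<le> lyap s"
proof (rule DERIV_nonpos_imp_decreasing_open[where f = lyap, OF assms(2)])
  show "\<exists>y. (lyap has_real_derivative y) (at u) \<and> y \<le> 0" if "s < u" "u < t" for u
  proof -
    have "u > 0" using that assms by simp
    then show ?thesis
      using lyap_has_derivative[of u] dlyap_nonpos[of u] by (auto simp: at_within_nonneg)
  qed
  show "continuous_on {s..t} lyap"
    using assms(1) lyap_has_derivative
    by (intro continuous_on_subset[OF DERIV_continuous_on[of "{0..}" lyap dlyap]]) auto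
qed

lemma volterra_le_lyap:
  assumes "t \<ge> 0"
  shows "volterra Ss (S x t) \<le> lyap t" "volterra Vs (V x t) \<le> lyap t" "volterra Is (I x t) \<le> lyap t"
proof -
  let ?f = "\<lambda>x. volterra Ss (S x t) + volterra Vs (V x t) + volterra Is (I x t)"
  have nn: "0 \<le> volterra Ss (S y t)" "0 \<le> volterra Vs (V y t)" "0 \<le> volterra Is (I y t)" for y
    using positive[OF assms, of y] eqpos by (auto intro: volterra_nonneg)
  have "?f x \<le> lyap t" unfolding lyap_def
    by (intro member_le_sum add_nonneg_nonneg nn) auto
  with nn[of x] show "volterra Ss (S x t) \<le> lyap t" "volterra Vs (V x t) \<le> lyap t" "volterra Is (I x t) \<le> lyap t"
    by linarith+
qed

lemma uniform_bounds:
  obtains m M where "m > 0"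
    "\<And>x t. t \<ge> 0 \<Longrightarrow> m \<le> S x t \<and> S x t \<le> M"
    "\<And>x t. t \<ge> 0 \<Longrightarrow> m \<le> V x t \<and> V x t \<le> M"
    "\<And>x t. t \<ge> 0 \<Longrightarrow> m \<le> I x t \<and> I x t \<le> M"
proof -
  obtain m1 M1 where 1: "m1 > 0" "\<And>z. z > 0 \<Longrightarrow> volterra Ss z \<le> lyap 0 \<Longrightarrow> m1 \<le> z \<and> z \<le> M1"
    by (fact volterra_sublevel_bounds[OF eqpos(1)])
  obtain m2 M2 where 2: "m2 > 0" "\<And>z. z > 0 \<Longrightarrow> volterra Vs z \<le> lyap 0 \<Longrightarrow> m2 \<le> z \<and> z \<le> M2"
    by (fact volterra_sublevel_bounds[OF eqpos(2)])
  obtain m3 M3 where 3: "m3 > 0" "\<And>z. z > 0 \<Longrightarrow> volterra Is z \<le> lyap 0 \<Longrightarrow> m3 \<le> z \<and> z \<le> M3"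
    by (fact volterra_sublevel_bounds[OF eqpos(3)])
  have le: "volterra Ss (S x t) \<le> lyap 0" "volterra Vs (V x t) \<le> lyap 0" "volterra Is (I x t) \<le> lyap 0"
    if "t \<ge> 0" for x t
    using volterra_le_lyap[OF that, of x] lyap_antimono[OF order_refl that] by linarith+
  show ?thesis
  proof (rule that[of "min m1 (min m2 m3)" "max M1 (max M2 M3)"])
    show "min m1 (min m2 m3) > 0" using 1 2 3 by simp
    show "min m1 (min m2 m3) \<le> S x t \<and> S x t \<le> max M1 (max M2 M3)" if "t \<ge> 0" for x t
      using 1(2)[of "S x t"] le(1)[OF that, of x] positive[OF that, of x] by auto
    show "min m1 (min m2 m3) \<le> V x t \<and> V x t \<le> max M1 (max M2 M3)" if "t \<ge> 0" for x t
      using 2(2)[of "V x t"] le(2)[OF that, of x] positive[OF that, of x] by auto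
    show "min m1 (min m2 m3) \<le> I x t \<and> I x t \<le> max M1 (max M2 M3)" if "t \<ge> 0" for x t
      using 3(2)[of "I x t"] le(3)[OF that, of x] positive[OF that, of x] by auto
  qed
qed

lemma bounded_lipschitz_solution:
  "bounded_lipschitz (S x)" "bounded_lipschitz (V x)" "bounded_lipschitz (I x)"
proof -
  obtain m M where b: "m > 0"
    "\<And>x t. t \<ge> 0 \<Longrightarrow> m \<le> S x t \<and> S x t \<le> M"
    "\<And>x t. t \<ge> 0 \<Longrightarrow> m \<le> V x t \<and> V x t \<le> M"
    "\<And>x t. t \<ge> 0 \<Longrightarrow> m \<le> I x t \<and> I x t \<le> M" by (fact uniform_bounds)
  have absM: "\<bar>S x t\<bar> \<le> M" "\<bar>V x t\<bar> \<le> M" "\<bar>I x t\<bar> \<le> M" if "t \<ge> 0" for x t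
    using b(1) b(2-4)[OF that, of x] by auto
  have bd: "bounded (S x ` {0..})" "bounded (V x ` {0..})" "bounded (I x ` {0..})" for x
    unfolding bounded_iff using absM[of _ x] by (auto intro!: exI[of _ M])
  have bc: "bounded ((\<lambda>t. c) ` {0..})" for c :: real
    by (simp add: image_constant_conv)
  have "bounded (dS x ` {0..})" "bounded (dV x ` {0..})" "bounded (dI x ` {0..})"
    unfolding dS_def[abs_def] dV_def[abs_def] dI_def[abs_def] graph_laplacian_def
    by (intro bounded_plus_comp bounded_minus_comp bounded_mult_image bounded_sum_image bd bc)+
  with bd[of x] has_derivative_within[of _ x]
  show "bounded_lipschitz (S x)" "bounded_lipschitz (V x)" "bounded_lipschitz (I x)"
    using bounded_lipschitz_of_derivative[of "S x" "dS x"] bounded_lipschitz_of_derivative[of "V x" "dV x"]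
      bounded_lipschitz_of_derivative[of "I x" "dI x"] by auto
qed

lemma bounded_lipschitz_derivatives:
  "bounded_lipschitz (dS x)" "bounded_lipschitz (dV x)" "bounded_lipschitz (dI x)"
  unfolding dS_def[abs_def] dV_def[abs_def] dI_def[abs_def] graph_laplacian_def
  by (intro bounded_lipschitz_add bounded_lipschitz_diff bounded_lipschitz_mult
      bounded_lipschitz_sum bounded_lipschitz_solution bounded_lipschitz_const)+

lemma bounded_lipschitz_dlyap: "bounded_lipschitz dlyap"
proof -
  obtain m M where b: "m > 0"
    "\<And>x t. t \<ge> 0 \<Longrightarrow> m \<le> S x t \<and> S x t \<le> M"
    "\<And>x t. t \<ge> 0 \<Longrightarrow> m \<le> V x t \<and> V x t \<le> M"
    "\<And>x t. t \<ge> 0 \<Longrightarrow> m \<le> I x t \<and> I x t \<le> M" by (fact uniform_bounds)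
  have "bounded_lipschitz (\<lambda>t. inverse (S x t))" "bounded_lipschitz (\<lambda>t. inverse (V x t))"
    "bounded_lipschitz (\<lambda>t. inverse (I x t))" for x
    using b by (auto intro!: bounded_lipschitz_inverse[where m = m] bounded_lipschitz_solution)
  then show ?thesis
    unfolding dlyap_def[abs_def] divide_inverse
    by (intro bounded_lipschitz_sum bounded_lipschitz_add bounded_lipschitz_diff
        bounded_lipschitz_mult bounded_lipschitz_derivatives bounded_lipschitz_const)
qed

lemma dlyap_tendsto: "(dlyap \<longlongrightarrow> 0) at_top"
proof -
  have "0 \<le> lyap t" if "t \<ge> 0" for t
    using volterra_le_lyap(1)[OF that] volterra_nonneg[OF eqpos(1)] positive[OF that]
    by (meson order_trans)
  then obtain l where "(lyap \<longlongrightarrow> l) at_top"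
    using nonincreasing_bounded_below_tendsto[of lyap 0] lyap_antimono by blast
  with lyap_has_derivative bounded_lipschitz_dlyap show ?thesis
    by (blast intro: derivative_tendsto_zero)
qed

lemma tendsto_equilibrium_component:
  assumes "a > 0" and f: "\<And>t. t \<ge> 0 \<Longrightarrow> 0 < f t \<and> f t \<le> M"
    and q: "\<And>t. t \<ge> 0 \<Longrightarrow> (f t / a - 1)\<^sup>2 / (f t / a) \<le> - dlyap t / rate"
  shows "(f \<longlongrightarrow> a) at_top"
proof -
  have "((\<lambda>t. (f t / a - 1)\<^sup>2) \<longlongrightarrow> 0) at_top"
  proof (rule tendsto_sandwich[OF _ _ tendsto_const])
    show "\<forall>\<^sub>F t in at_top. 0 \<le> (f t / a - 1)\<^sup>2" by simp
    show "\<forall>\<^sub>F t in at_top. (f t / a - 1)\<^sup>2 \<le> M / a * (- dlyap t / rate)"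
      using eventually_ge_at_top[of 0]
    proof eventually_elim
      case (elim t)
      have "(f t / a - 1)\<^sup>2 = f t / a * ((f t / a - 1)\<^sup>2 / (f t / a))"
        using f[OF elim] \<open>a > 0\<close> by simp
      also have "\<dots> \<le> M / a * (- dlyap t / rate)"
        using f[OF elim] q[OF elim] \<open>a > 0\<close> by (intro mult_mono divide_right_mono) auto
      finally show ?case .
    qed
    have "((\<lambda>t. M / a * (- dlyap t / rate)) \<longlongrightarrow> M / a * (- 0 / rate)) at_top"
      using rate_pos by (intro tendsto_intros dlyap_tendsto) auto
    then show "((\<lambda>t. M / a * (- dlyap t / rate)) \<longlongrightarrow> 0) at_top" by simp
  qed
  then have "((\<lambda>t. sqrt ((f t / a - 1)\<^sup>2)) \<longlongrightarrow> sqrt 0) at_top"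
    by (rule tendsto_real_sqrt)
  then have "((\<lambda>t. f t / a - 1) \<longlongrightarrow> 0) at_top"
    by (simp add: tendsto_rabs_zero_iff)
  then have "((\<lambda>t. a * (f t / a - 1 + 1)) \<longlongrightarrow> a * (0 + 1)) at_top"
    by (intro tendsto_intros)
  then show ?thesis using \<open>a > 0\<close> by simp
qed

lemma tendsto_S: "(S x \<longlongrightarrow> Ss) at_top" and tendsto_V: "(V x \<longlongrightarrow> Vs) at_top"
proof -
  obtain m M where b: "m > 0"
    "\<And>x t. t \<ge> 0 \<Longrightarrow> m \<le> S x t \<and> S x t \<le> M"
    "\<And>x t. t \<ge> 0 \<Longrightarrow> m \<le> V x t \<and> V x t \<le> M"
    "\<And>x t. t \<ge> 0 \<Longrightarrow> m \<le> I x t \<and> I x t \<le> M" by (fact uniform_bounds)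
  show "(S x \<longlongrightarrow> Ss) at_top" "(V x \<longlongrightarrow> Vs) at_top"
    using b positive eqpos quotient_squares_le
    by (auto intro!: tendsto_equilibrium_component[where M = M])
qed

lemma tendsto_I: "(I x \<longlongrightarrow> Is) at_top"
proof -
  define J where "J t = (\<epsilon> * graph_laplacian w (\<lambda>y. S y t) x + \<mu> * (1 - r) * N - (\<mu> + p) * S x t
      + \<xi> * V x t - dS x t) / (\<beta> * S x t)" for t
  have "(dS x \<longlongrightarrow> 0) at_top"
    using has_derivative_within(1) tendsto_S bounded_lipschitz_derivatives(1)
    by (rule derivative_tendsto_zero)
  then have "(J \<longlongrightarrow> (\<epsilon> * graph_laplacian w (\<lambda>y. Ss) x + \<mu> * (1 - r) * N - (\<mu> + p) * Ss
      + \<xi> * Vs - 0) / (\<beta> * Ss)) at_top"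
    unfolding J_def[abs_def] graph_laplacian_def
    using beta eqpos by (intro tendsto_intros tendsto_S tendsto_V) auto
  also have "(\<epsilon> * graph_laplacian w (\<lambda>y. Ss) x + \<mu> * (1 - r) * N - (\<mu> + p) * Ss + \<xi> * Vs - 0) / (\<beta> * Ss) = Is"
    using eq beta eqpos unfolding svirs_equilibrium_def graph_laplacian_def by (simp add: field_simps)
  finally have "(J \<longlongrightarrow> Is) at_top" .
  moreover have "\<forall>\<^sub>F t in at_top. J t = I x t"
    using eventually_ge_at_top[of 0]
  proof eventually_elim
    case (elim t)
    then show ?case using positive[OF elim, of x] beta unfolding J_def dS_def
      by (simp add: field_simps)
  qed
  ultimately show ?thesis by (rule Lim_transform_eventually)
qed

end

theorem theorem1:
  fixes w :: "'v::finite \<Rightarrow> 'v \<Rightarrow> real"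
    and \<epsilon> N r \<mu> \<beta> p \<xi> \<sigma> \<gamma> Ss Vs Is :: real
    and S V I :: "'v \<Rightarrow> real \<Rightarrow> real"
  assumes graph: "weighted_graph w"
    and N: "0 < N" and r: "0 < r" "r < 1" and mu: "0 < \<mu>" and beta: "0 < \<beta>"
    and p: "0 \<le> p" "p \<le> 1" and sigma: "0 \<le> \<sigma>" "\<sigma> \<le> 1"
    and eps: "0 < \<epsilon>" "\<epsilon> \<le> 1"
    and xi: "0 \<le> \<xi>" and gamma: "0 \<le> \<gamma>"
    and R0: "R0_svirs N r \<mu> \<beta> p \<xi> \<sigma> \<gamma> > 1"
    and eq: "svirs_equilibrium N r \<mu> \<beta> p \<xi> \<sigma> \<gamma> 0 Ss Vs Is"
    and eqpos: "0 < Ss" "0 < Vs" "0 < Is"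
    and sol: "svirs_solution w \<epsilon> N r \<mu> \<beta> p \<xi> \<sigma> \<gamma> 0 S V I"
    and init: "\<forall>x. 0 < S x 0 \<and> 0 < V x 0 \<and> 0 < I x 0"
  shows "\<forall>e>0. \<forall>\<^sub>F t in at_top.
           \<forall>x. \<bar>S x t - Ss\<bar> < e \<and> \<bar>V x t - Vs\<bar> < e \<and> \<bar>I x t - Is\<bar> < e"
proof (intro allI impI)
  fix e :: real assume "e > 0"
  interpret svirs w \<epsilon> N r \<mu> \<beta> p \<xi> \<sigma> \<gamma> Ss Vs Is S V I
    by unfold_locales (use assms in auto)
  have "\<forall>\<^sub>F t in at_top. \<bar>S x t - Ss\<bar> < e \<and> \<bar>V x t - Vs\<bar> < e \<and> \<bar>I x t - Is\<bar> < e" for x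
    using tendstoD[OF tendsto_S[of x] \<open>e > 0\<close>] tendstoD[OF tendsto_V[of x] \<open>e > 0\<close>]
      tendstoD[OF tendsto_I[of x] \<open>e > 0\<close>]
    by eventually_elim (simp add: dist_real_def)
  then show "\<forall>\<^sub>F t in at_top. \<forall>x. \<bar>S x t - Ss\<bar> < e \<and> \<bar>V x t - Vs\<bar> < e \<and> \<bar>I x t - Is\<bar> < e"
    by (rule eventually_all_finite)
qed

end
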